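(* If $G$ is the elementary abelian $2$-group of order $n=2^r$, then $C_3(G)=n/2+1$.
   Context: $G$ is written additively. For $A\subseteq G$ and a positive integer $h$, $h\hat{\;}A$ denotes the set of all sums of $h$ pairwise distinct elements of $A$. $C_h(G)=\max\{|A| : A\subseteq G,\ h\hat{\;}A\neq G\}$. *)

theory Defs
  imports "HOL-Library.Cardinality"
begin

definition restricted_sumset :: "nat \<Rightarrow> 'a::ab_group_add set \<Rightarrow> 'a set"  
  where "restricted_sumset h A = {\<Sum>x\<in>B. x | B. B \<subseteq> A \<and> finite B \<and> card B = h}"

(* The group G is the whole type 'a. The maximum is over a finite set, which is
   nonempty for h \<ge> 1, since A = {} has no sums of h distinct elements. *)
definition restricted_critical :: "nat \<Rightarrow> 'a::{ab_group_add, finite} itself \<Rightarrow> nat"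
  where "restricted_critical h G = Max {card A | A :: 'a set. restricted_sumset h A \<noteq> UNIV}"

end

theory Submission
  imports Defs
begin

text \<open>
  Upper bound: translating \<open>A\<close> by \<open>x\<close> also translates its threefold sums by \<open>3 x = x\<close>, so it suffices
  to represent \<open>0\<close>. For a nonzero \<open>a \<in> A\<close> the sets \<open>A\<close> and \<open>a + A\<close> meet in at least
  \<open>2 |A| - n \<ge> 3\<close> points; one of these is some \<open>b \<notin> {0, a}\<close>, and \<open>a + b + (a + b) = 0\<close>.
  Lower bound: let \<open>H\<close> be a subgroup of index 2 and \<open>g \<notin> H\<close>. A sum of three distinct elements of
  \<open>H \<union> {g}\<close> equal to \<open>g\<close> would have to involve \<open>g\<close> and two distinct elements of \<open>H\<close> with sum \<open>0\<close>.
\<close>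

lemma mem_restricted_sumset_3_iff:
  "x \<in> restricted_sumset 3 A \<longleftrightarrow>
    (\<exists>a\<in>A. \<exists>b\<in>A. \<exists>c\<in>A. a \<noteq> b \<and> a \<noteq> c \<and> b \<noteq> c \<and> x = a + b + c)"
proof
  assume "x \<in> restricted_sumset 3 A"
  then obtain B where B: "B \<subseteq> A" "card B = 3" "x = \<Sum>B"
    by (auto simp: restricted_sumset_def)
  then obtain a b c where "B = {a, b, c}" "a \<noteq> b" "a \<noteq> c" "b \<noteq> c"
    by (auto simp: card_3_iff)
  with B show "\<exists>a\<in>A. \<exists>b\<in>A. \<exists>c\<in>A. a \<noteq> b \<and> a \<noteq> c \<and> b \<noteq> c \<and> x = a + b + c"
    by (force simp: add.assoc)
next
  assume "\<exists>a\<in>A. \<exists>b\<in>A. \<exists>c\<in>A. a \<noteq> b \<and> a \<noteq> c \<and> b \<noteq> c \<and> x = a + b + c"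
  then obtain a b c where "a \<in> A" "b \<in> A" "c \<in> A" "a \<noteq> b" "a \<noteq> c" "b \<noteq> c" "x = a + b + c"
    by blast
  then have "x = \<Sum>{a, b, c} \<and> {a, b, c} \<subseteq> A \<and> finite {a, b, c} \<and> card {a, b, c} = 3"
    by (auto simp: add.assoc)
  then show "x \<in> restricted_sumset 3 A"
    unfolding restricted_sumset_def by blast
qed

lemma card_translate: "card ((+) (a :: 'a::ab_group_add) ` A) = card A"
  by (simp add: card_image)

lemma uminus_eq_self_if_involutive:
  fixes x :: "'a::ab_group_add"
  assumes "\<forall>x :: 'a. x + x = 0"
  shows "- x = x"
  using assms by (metis add_eq_0_iff)

lemma zero_mem_restricted_sumset_3:
  fixes A :: "'a::{ab_group_add, finite} set"
  assumes inv: "\<forall>x :: 'a. x + x = 0" and card: "CARD('a) div 2 + 2 \<le> card A"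
  shows "0 \<in> restricted_sumset 3 A"
proof -
  have "\<not> A \<subseteq> {0}"
    using card card_mono[of "{0}" A] by auto
  then obtain a where a: "a \<in> A" "a \<noteq> 0" by blast
  have "card (A \<union> (+) a ` A) \<le> CARD('a)"
    by (rule card_mono) auto
  moreover have "card A + card ((+) a ` A) = card (A \<union> (+) a ` A) + card (A \<inter> (+) a ` A)"
    by (rule card_Un_Int) auto
  \<comment> \<open>Rounding in \<open>CARD('a) div 2\<close> costs at most 1 after doubling, so
    \<open>2 * card A\<close> is at least \<open>CARD('a) + 3\<close>.\<close>
  ultimately have "3 \<le> card (A \<inter> (+) a ` A)"
    using card by (simp only: card_translate)
  then have "\<not> A \<inter> (+) a ` A \<subseteq> {0, a}"
    using card_mono[of "{0, a}" "A \<inter> (+) a ` A"] a by auto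
  \<comment> \<open>The common point is \<open>a + c\<close>. That it is not \<open>0\<close>
    separates \<open>a\<close> from \<open>c\<close>, that it is not \<open>a\<close> separates it
    from \<open>a\<close>, and \<open>a \<noteq> 0\<close> separates it from
    \<open>c\<close>.\<close>
  then obtain c where c: "c \<in> A" "a + c \<in> A" "a + c \<noteq> 0" "a + c \<noteq> a" by blast
  have "0 = a + c + (a + c)" "a \<noteq> c"
    using c inv by auto
  then have "0 = a + c + (a + c) \<and> a \<noteq> c \<and> a \<noteq> a + c \<and> c \<noteq> a + c"
    using a c by auto
  then show ?thesis
    using a c unfolding mem_restricted_sumset_3_iff by blast
qed

lemma restricted_sumset_3_eq_UNIV:
  fixes A :: "'a::{ab_group_add, finite} set"
  assumes inv: "\<forall>x :: 'a. x + x = 0" and card: "CARD('a) div 2 + 2 \<le> card A"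
  shows "restricted_sumset 3 A = UNIV"
proof (rule UNIV_eq_I[symmetric])
  fix x :: 'a
  have "0 \<in> restricted_sumset 3 ((+) x ` A)"
    using zero_mem_restricted_sumset_3[OF inv] card by (simp only: card_translate)
  then obtain a b c where abc: "a \<in> A" "b \<in> A" "c \<in> A" "a \<noteq> b" "a \<noteq> c" "b \<noteq> c"
    and "0 = (x + a) + (x + b) + (x + c)"
    unfolding mem_restricted_sumset_3_iff by blast
  then have "0 = (x + x) + (x + (a + b + c))" by (simp add: algebra_simps)
  then have "a + b + c = - x" using inv by (simp add: eq_neg_iff_add_eq_0 add.commute)
  then have "x = a + b + c" using uminus_eq_self_if_involutive[OF inv] by simp
  with abc show "x \<in> restricted_sumset 3 A"
    unfolding mem_restricted_sumset_3_iff by blast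
qed

text \<open>No linear algebra is needed: a maximal proper subgroup \<open>H\<close> has index 2, since
  \<open>H \<union> (g + H)\<close> is again a subgroup for every \<open>g\<close>.\<close>
lemma exists_index_2_subgroup:
  assumes inv: "\<forall>x :: 'a::{ab_group_add, finite}. x + x = 0" and nontrivial: "CARD('a) \<noteq> 1"
  obtains H :: "'a::{ab_group_add, finite} set" where "\<And>x y. x \<in> H \<Longrightarrow> y \<in> H \<Longrightarrow> x + y \<in> H" "CARD('a) = 2 * card H"
proof -
  \<comment> \<open>As \<open>- x = x\<close>, containing \<open>0\<close> and being closed under
    addition makes a set a subgroup.\<close>
  define S where "S = {H :: 'a set. 0 \<in> H \<and> (\<forall>x\<in>H. \<forall>y\<in>H. x + y \<in> H) \<and> H \<noteq> UNIV}"
  have "{0} \<in> S"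
    using nontrivial by (auto simp: S_def) (metis card_1_singleton_iff One_nat_def)
  then obtain H where H: "H \<in> S" and max: "\<And>K. K \<in> S \<Longrightarrow> H \<subseteq> K \<Longrightarrow> H = K"
    using finite_has_maximal[of S] by auto
  have zero: "0 \<in> H" and add: "\<And>x y. x \<in> H \<Longrightarrow> y \<in> H \<Longrightarrow> x + y \<in> H" and "H \<noteq> UNIV"
    using H by (auto simp: S_def)
  then obtain g where g: "g \<notin> H" by blast
  have gg: "g + (g + x) = x" for x
    using inv by (simp add: add.assoc[symmetric])
  define K where "K = H \<union> (+) g ` H"
  \<comment> \<open>Two elements of the coset add up to an element of \<open>H\<close>, because the
    two copies of \<open>g\<close> cancel.\<close>
  have "x + y \<in> K" if "x \<in> K" "y \<in> K" for x y
    using that add unfolding K_def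
    by (elim UnE imageE) (auto simp: gg add.assoc add.left_commute)
  moreover have "0 \<in> K" "H \<subseteq> K" using zero by (auto simp: K_def)
  moreover have "g \<in> K" using zero by (force simp: K_def)
  \<comment> \<open>\<open>K\<close> is strictly larger than \<open>H\<close>, so by maximality it
    cannot be proper.\<close>
  ultimately have "H \<union> (+) g ` H = UNIV"
    using max[of K] g by (auto simp: S_def K_def)
  moreover have "H \<inter> (+) g ` H = {}"
  proof -
    \<comment> \<open>A common point \<open>g + x\<close> with \<open>x \<in> H\<close> would put
      \<open>g\<close> itself into \<open>H\<close>.\<close>
    have "g = (g + x) + x" for x using inv by (simp add: add.assoc)
    then show ?thesis using g add by (metis disjoint_iff imageE)
  qed
  then have "card (H \<union> (+) g ` H) = 2 * card H"
    by (simp add: card_Un_disjoint card_translate)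
  ultimately show ?thesis using that[of H] add by simp
qed

lemma not_mem_restricted_sumset_3_insert:
  fixes H :: "'a::ab_group_add set"
  assumes inv: "\<forall>x :: 'a. x + x = 0" and add: "\<And>x y. x \<in> H \<Longrightarrow> y \<in> H \<Longrightarrow> x + y \<in> H"
    and g: "g \<notin> H"
  shows "g \<notin> restricted_sumset 3 (insert g H)"
proof
  have eq: "x = y" if "x + y = 0" for x y :: 'a
    using that uminus_eq_self_if_involutive[OF inv] by (metis add_eq_0_iff)
  assume "g \<in> restricted_sumset 3 (insert g H)"
  then obtain a b c where mem: "a \<in> insert g H" "b \<in> insert g H" "c \<in> insert g H"
    and ne: "a \<noteq> b" "a \<noteq> c" "b \<noteq> c" and sum: "g = a + b + c"
    unfolding mem_restricted_sumset_3_iff by blast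
  have "a + b + c \<in> H" if "a \<in> H" "b \<in> H" "c \<in> H" using add that by blast
  then consider "a = g" | "b = g" | "c = g" using mem g sum by auto
  then show False
    \<comment> \<open>Cancelling \<open>g\<close> leaves the other two summands with sum
      \<open>0\<close>, and \<open>eq\<close> contradicts their distinctness.\<close>
    using sum ne eq[of b c] eq[of a c] eq[of a b]
    by cases (auto simp: add.assoc add.left_commute)
qed

theorem theorem2p5:
  fixes n r :: nat
  assumes elementary_abelian: "\<forall>x :: 'a::{ab_group_add, finite}. x + x = 0"
    and "CARD('a) = n" and "n = 2 ^ r"
  shows "restricted_critical 3 TYPE('a) = n div 2 + 1"
proof -
  have "card A \<le> n div 2 + 1" if "restricted_sumset 3 A \<noteq> UNIV" for A :: "'a set"
    using that restricted_sumset_3_eq_UNIV[OF elementary_abelian, of A] assms(2) by linarith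
  moreover have "\<exists>A :: 'a set. card A = n div 2 + 1 \<and> restricted_sumset 3 A \<noteq> UNIV"
  proof (cases "n = 1")
    case True
    \<comment> \<open>The trivial group has no subgroup of index 2, but here
      \<open>n div 2 + 1\<close> is 1 and a singleton has no three distinct elements.\<close>
    have "0 \<notin> restricted_sumset 3 {0 :: 'a}" by (simp add: mem_restricted_sumset_3_iff)
    with True show ?thesis by (intro exI[of _ "{0}"]) auto
  next
    case False
    with assms(2) obtain H :: "'a set"
      where add: "\<And>x y. x \<in> H \<Longrightarrow> y \<in> H \<Longrightarrow> x + y \<in> H" and n: "n = 2 * card H"
      using exists_index_2_subgroup[OF elementary_abelian] by metis
    have "n > 0" using assms(2) by auto
    with n assms(2) have "H \<noteq> UNIV" by auto
    then obtain g where g: "g \<notin> H" by blast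
    then have "card (insert g H) = n div 2 + 1" using n by simp
    moreover have "restricted_sumset 3 (insert g H) \<noteq> UNIV"
      using not_mem_restricted_sumset_3_insert[OF elementary_abelian add g] by blast
    ultimately show ?thesis by blast
  qed
  ultimately show ?thesis
    unfolding restricted_critical_def by (intro Max_eqI) auto
qed

end
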